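(* Let $G$ be a group which satisfies the conditions min-n and max-n, and suppose that for every element $h\in G$ the class $[e]_h$ is a subgroup of $G$. Then $G$ is nilpotent.
   Context: For $h\in G$, $[e]_h=\{z^{-1}h^{-1}zh\mid z\in G\}$ is the twisted conjugacy class of the unit element $e$ with respect to the inner automorphism $x\mapsto h^{-1}xh$. The condition min-n (respectively max-n) is the descending (respectively ascending) chain condition on normal subgroups of $G$. *)

theory Defs
  imports "HOL-Algebra.Algebra"
begin

definition min_n :: "('a, 'b) monoid_scheme \<Rightarrow> bool" where
  "min_n G \<longleftrightarrow>
     (\<forall>N :: nat \<Rightarrow> 'a set. (\<forall>i. N i \<lhd> G) \<longrightarrow> (\<forall>i. N (Suc i) \<subseteq> N i) \<longrightarrow>
        (\<exists>m. \<forall>i\<ge>m. N i = N m))"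

definition max_n :: "('a, 'b) monoid_scheme \<Rightarrow> bool" where
  "max_n G \<longleftrightarrow>
     (\<forall>N :: nat \<Rightarrow> 'a set. (\<forall>i. N i \<lhd> G) \<longrightarrow> (\<forall>i. N i \<subseteq> N (Suc i)) \<longrightarrow>
        (\<exists>m. \<forall>i\<ge>m. N i = N m))"

text \<open>
  The twisted conjugacy class of \<open>x\<close> with respect to an endomorphism \<open>\<phi>\<close> of \<open>G\<close>
  consists of the elements \<open>inv z \<otimes> x \<otimes> \<phi> z\<close>.
\<close>

definition twisted_conj_class ::
    "('a, 'b) monoid_scheme \<Rightarrow> ('a \<Rightarrow> 'a) \<Rightarrow> 'a \<Rightarrow> 'a set" where
  "twisted_conj_class G \<phi> x = {inv\<^bsub>G\<^esub> z \<otimes>\<^bsub>G\<^esub> x \<otimes>\<^bsub>G\<^esub> \<phi> z | z. z \<in> carrier G}"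

definition unit_class :: "('a, 'b) monoid_scheme \<Rightarrow> 'a \<Rightarrow> 'a set" where
  "unit_class G h =
     {inv\<^bsub>G\<^esub> z \<otimes>\<^bsub>G\<^esub> inv\<^bsub>G\<^esub> h \<otimes>\<^bsub>G\<^esub> z \<otimes>\<^bsub>G\<^esub> h | z. z \<in> carrier G}"

lemma (in group) unit_class_eq_twisted_conj_class:
  assumes "h \<in> carrier G"
  shows "unit_class G h = twisted_conj_class G (\<lambda>x. inv h \<otimes> x \<otimes> h) \<one>"
proof -
  have "inv z \<otimes> \<one> \<otimes> (inv h \<otimes> z \<otimes> h) = inv z \<otimes> inv h \<otimes> z \<otimes> h" if "z \<in> carrier G" for z
    using that assms by (simp add: m_assoc)
  then show ?thesis
    unfolding unit_class_def twisted_conj_class_def by (intro Collect_cong) metis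
qed

text \<open>Mixed version of \<open>derived\<close>, with the same convention for commutators.\<close>

definition commutator_subgroup ::
    "('a, 'b) monoid_scheme \<Rightarrow> 'a set \<Rightarrow> 'a set \<Rightarrow> 'a set" where
  "commutator_subgroup G H K =
     generate G {h \<otimes>\<^bsub>G\<^esub> k \<otimes>\<^bsub>G\<^esub> inv\<^bsub>G\<^esub> h \<otimes>\<^bsub>G\<^esub> inv\<^bsub>G\<^esub> k | h k. h \<in> H \<and> k \<in> K}"

lemma derived_eq_commutator_subgroup: "derived G H = commutator_subgroup G H H"
  unfolding derived_def commutator_subgroup_def by (rule arg_cong[of _ _ "generate G"]) blast

primrec lower_central :: "('a, 'b) monoid_scheme \<Rightarrow> nat \<Rightarrow> 'a set" where
  "lower_central G 0 = carrier G"
| "lower_central G (Suc n) = commutator_subgroup G (lower_central G n) (carrier G)"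

definition nilpotent_group :: "('a, 'b) monoid_scheme \<Rightarrow> bool" where
  "nilpotent_group G \<longleftrightarrow> (\<exists>n. lower_central G n = {\<one>\<^bsub>G\<^esub>})"

end

theory Submission
  imports Defs
begin

text \<open>
  Write \<open>[z, h] = z\<^sup>-\<^sup>1 h\<^sup>-\<^sup>1 z h\<close>, so that \<open>unit_class G h\<close> is the set of all \<open>[z, h]\<close>. Two facts
  about this set carry the proof.

  First, the identity \<open>[z w, h] = w\<^sup>-\<^sup>1 [z, h] w [w, h]\<close> shows that the class is normal as soon as
  it is a subgroup (\<open>unit_class_normal\<close>).

  Second, an element \<open>x\<close> that is congruent to some \<open>[z, x]\<close> modulo a normal subgroup \<open>M\<close> lies in
  \<open>M\<close>: cancelling \<open>x\<close> in \<open>x \<equiv> z\<^sup>-\<^sup>1 x\<^sup>-\<^sup>1 z x\<close> makes the conjugate \<open>z\<^sup>-\<^sup>1 x\<^sup>-\<^sup>1 z\<close> trivial modulo \<open>M\<close>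
  (\<open>self_in_unit_class_mod\<close>).

  Together they force every chief factor \<open>L / M\<close> to be central. For \<open>x \<in> L\<close> the product of
  \<open>unit_class G x\<close> with \<open>M\<close> is a normal subgroup between \<open>M\<close> and \<open>L\<close>. If it were \<open>L\<close>, it would
  contain \<open>x\<close>, and the second fact would give \<open>x \<in> M\<close> and hence product \<open>M\<close>. So the product is
  always \<open>M\<close>, that is, \<open>[L, G] \<le> M\<close> (\<open>chief_factor_central\<close>).

  Now min-n makes the lower central series stop at some \<open>L = [L, G]\<close>. If \<open>L\<close> were nontrivial,
  max-n would supply a chief factor \<open>L / M\<close> with \<open>M < L\<close>, and centrality would give
  \<open>L = [L, G] \<le> M\<close>.
\<close>

section \<open>The lower central series\<close>

context group
begin

lemma commutator_subgroup_subset_normal: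
  assumes "H \<lhd> G"
  shows "commutator_subgroup G H (carrier G) \<subseteq> H"
  unfolding commutator_subgroup_def
proof (rule generate_subgroup_incl)
  show H: "subgroup H G"
    using assms by (rule normal_imp_subgroup)
  have "h \<otimes> k \<otimes> inv h \<otimes> inv k \<in> H" if "h \<in> H" "k \<in> carrier G" for h k
  proof -
    have h: "h \<in> carrier G"
      using that(1) by (rule subgroup.mem_carrier[OF H])
    have "k \<otimes> inv h \<otimes> inv k \<in> H"
      using normal.inv_op_closed2[OF assms] that subgroup.m_inv_closed[OF H] by blast
    then have "h \<otimes> (k \<otimes> inv h \<otimes> inv k) \<in> H"
      using that subgroup.m_closed[OF H] by blast
    then show ?thesis
      using that h by (simp add: m_assoc)
  qed
  then show "{h \<otimes> k \<otimes> inv h \<otimes> inv k |h k. h \<in> H \<and> k \<in> carrier G} \<subseteq> H"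
    by blast
qed

lemma commutator_subgroup_normal:
  assumes "H \<lhd> G"
  shows "commutator_subgroup G H (carrier G) \<lhd> G"
  unfolding commutator_subgroup_def
proof (rule normal_generateI)
  have Hc: "H \<subseteq> carrier G"
    using assms by (simp add: normal_imp_subgroup subgroup.subset)
  then show "{h \<otimes> k \<otimes> inv h \<otimes> inv k |h k. h \<in> H \<and> k \<in> carrier G} \<subseteq> carrier G"
    by auto
  fix c g
  assume "c \<in> {h \<otimes> k \<otimes> inv h \<otimes> inv k |h k. h \<in> H \<and> k \<in> carrier G}" and g: "g \<in> carrier G"
  then obtain h k where c: "c = h \<otimes> k \<otimes> inv h \<otimes> inv k" and h: "h \<in> H" and k: "k \<in> carrier G"
    by blast
  define h' k' where "h' = g \<otimes> h \<otimes> inv g" and "k' = g \<otimes> k \<otimes> inv g"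
  have hc: "h \<in> carrier G"
    using h Hc by blast
  have cancel: "inv g \<otimes> (g \<otimes> a) = a" if "a \<in> carrier G" for a
    using g that by (simp add: m_assoc[symmetric])
  have "g \<otimes> c \<otimes> inv g = h' \<otimes> k' \<otimes> inv h' \<otimes> inv k'"
    using g k hc by (simp add: c h'_def k'_def m_assoc inv_mult_group cancel)
  moreover have "h' \<in> H" "k' \<in> carrier G"
    using normal.inv_op_closed2[OF assms g h] g k by (simp_all add: h'_def k'_def)
  ultimately show "g \<otimes> c \<otimes> inv g \<in> {h \<otimes> k \<otimes> inv h \<otimes> inv k |h k. h \<in> H \<and> k \<in> carrier G}"
    by blast
qed

lemma lower_central_normal: "lower_central G n \<lhd> G"
  by (induction n) (simp_all add: normal_self commutator_subgroup_normal)

end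


section \<open>Classes of the unit element\<close>

context group
begin

lemma unit_class_normal:
  assumes h: "h \<in> carrier G" and sub: "subgroup (unit_class G h) G"
  shows "unit_class G h \<lhd> G"
proof (rule normal_invI[OF sub])
  fix g c
  assume g: "g \<in> carrier G" and "c \<in> unit_class G h"
  then obtain z where z: "z \<in> carrier G" and c: "c = inv z \<otimes> inv h \<otimes> z \<otimes> h"
    unfolding unit_class_def by blast
  \<comment> \<open>With \<open>w = g\<^sup>-\<^sup>1\<close> the conjugate \<open>g c g\<^sup>-\<^sup>1\<close> is the quotient of \<open>[z w, h]\<close> by \<open>[w, h]\<close>.\<close>
  define w where "w = inv g"
  define a where "a = inv (z \<otimes> w) \<otimes> inv h \<otimes> (z \<otimes> w) \<otimes> h"
  define b where "b = inv w \<otimes> inv h \<otimes> w \<otimes> h"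
  have w: "w \<in> carrier G"
    using g by (simp add: w_def)
  have "a \<in> unit_class G h" "b \<in> unit_class G h"
    unfolding unit_class_def a_def b_def using z w by blast+
  then have "a \<otimes> inv b \<in> unit_class G h"
    using sub by (simp add: subgroup.m_closed subgroup.m_inv_closed)
  moreover have "a \<otimes> inv b = g \<otimes> c \<otimes> inv g"
  proof -
    have cancel: "h \<otimes> (inv h \<otimes> y) = y" "w \<otimes> (inv w \<otimes> y) = y" if "y \<in> carrier G" for y
      using h w that by (simp_all add: m_assoc[symmetric])
    have "a \<otimes> inv b = inv w \<otimes> c \<otimes> w"
      using h z w by (simp add: a_def b_def c m_assoc inv_mult_group cancel)
    then show ?thesis
      using g by (simp add: w_def)
  qed
  ultimately show "g \<otimes> c \<otimes> inv g \<in> unit_class G h"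
    by simp
qed

lemma unit_class_subset_normal:
  assumes "N \<lhd> G" and x: "x \<in> N"
  shows "unit_class G x \<subseteq> N"
proof
  have N: "subgroup N G"
    using assms(1) by (rule normal_imp_subgroup)
  fix c
  assume "c \<in> unit_class G x"
  then obtain z where z: "z \<in> carrier G" and c: "c = (inv z \<otimes> inv x \<otimes> z) \<otimes> x"
    unfolding unit_class_def by blast
  have "inv z \<otimes> inv x \<otimes> z \<in> N"
    using normal.inv_op_closed1[OF assms(1) z] subgroup.m_inv_closed[OF N x] by blast
  then show "c \<in> N"
    unfolding c using subgroup.m_closed[OF N] x by blast
qed

text \<open>
  For trivial \<open>M\<close> this says that only the unit lies in its own class: \<open>x = z\<^sup>-\<^sup>1 x\<^sup>-\<^sup>1 z x\<close> forces
  \<open>z\<^sup>-\<^sup>1 x\<^sup>-\<^sup>1 z = \<one>\<close>. Keeping track of the error term in \<open>M\<close> gives the statement for \<open>G / M\<close>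
  without passing to the quotient.
\<close>

lemma self_in_unit_class_mod:
  assumes M: "M \<lhd> G" and x: "x \<in> carrier G" and mem: "x \<in> unit_class G x <#> M"
  shows "x \<in> M"
proof -
  obtain z m where z: "z \<in> carrier G" and m: "m \<in> M"
    and eq: "x = inv z \<otimes> inv x \<otimes> z \<otimes> x \<otimes> m"
    using mem unfolding unit_class_def set_mult_def by blast
  have mc: "m \<in> carrier G"
    using M m by (meson normal_imp_subgroup subgroup.mem_carrier)
  have cancel: "z \<otimes> (inv z \<otimes> y) = y" "x \<otimes> (inv x \<otimes> y) = y" if "y \<in> carrier G" for y
    using z x that by (simp_all add: m_assoc[symmetric])
  define y where "y = inv z \<otimes> x \<otimes> z"
  have yc: "y \<in> carrier G"
    using x z by (simp add: y_def)
  have "y \<otimes> x = y \<otimes> (inv z \<otimes> inv x \<otimes> z \<otimes> x \<otimes> m)"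
    using eq by (rule arg_cong)
  also have "\<dots> = inv z \<otimes> z \<otimes> (x \<otimes> m)"
    using x z mc by (simp only: y_def m_assoc cancel m_closed inv_closed)
  also have "\<dots> = x \<otimes> m"
    using x z mc by simp
  finally have "y = x \<otimes> m \<otimes> inv x"
    using x yc mc by (simp add: inv_solve_right)
  then have "y \<in> M"
    using normal.inv_op_closed2[OF M x m] by simp
  then have "z \<otimes> y \<otimes> inv z \<in> M"
    using normal.inv_op_closed2[OF M z] by blast
  moreover have "z \<otimes> y \<otimes> inv z = x"
    using x z by (simp add: y_def m_assoc cancel)
  ultimately show ?thesis
    by simp
qed


section \<open>Chief factors\<close>

text \<open>
  \<open>unit_class G x\<close> is normal, so maximality of \<open>M\<close> below \<open>L\<close> leaves only two values for its product
  with \<open>M\<close>. The value \<open>L\<close> puts \<open>x\<close> itself into the product, hence into \<open>M\<close>; in both cases the whole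
  class of \<open>x\<close> lies in \<open>M\<close>.
\<close>

lemma chief_factor_central:
  assumes L: "L \<lhd> G" and M: "M \<lhd> G" and M_le: "M \<subseteq> L"
    and chief: "\<And>K. \<lbrakk>K \<lhd> G; M \<subseteq> K; K \<subseteq> L\<rbrakk> \<Longrightarrow> K = M \<or> K = L"
    and sub: "\<And>h. h \<in> carrier G \<Longrightarrow> subgroup (unit_class G h) G"
  shows "commutator_subgroup G L (carrier G) \<subseteq> M"
proof -
  have Lsub: "subgroup L G" and Msub: "subgroup M G"
    using L M by (simp_all add: normal_imp_subgroup)
  have class_le: "unit_class G x \<subseteq> M" if x: "x \<in> L" for x
  proof -
    have xc: "x \<in> carrier G"
      using x by (rule subgroup.mem_carrier[OF Lsub])
    define C where "C = unit_class G x"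
    have C: "C \<lhd> G"
      unfolding C_def using xc sub by (simp add: unit_class_normal)
    then have Csub: "subgroup C G"
      by (rule normal_imp_subgroup)
    have CL: "C \<subseteq> L"
      unfolding C_def by (rule unit_class_subset_normal[OF L x])
    have "M \<subseteq> C <#> M"
    proof
      fix m assume "m \<in> M"
      then have "\<one> \<otimes> m \<in> C <#> M" "m \<in> carrier G"
        using subgroup.one_closed[OF Csub] subgroup.mem_carrier[OF Msub]
        unfolding set_mult_def by blast+
      then show "m \<in> C <#> M" by simp
    qed
    moreover have "C <#> M \<subseteq> L"
      unfolding set_mult_def using CL M_le subgroup.m_closed[OF Lsub] by blast
    ultimately have "C <#> M = M \<or> C <#> M = L"
      using chief normal_subgroup_set_mult_closed[OF C M] by blast
    then show ?thesis
    proof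
      assume prod: "C <#> M = M"
      have "c \<in> M" if "c \<in> C" for c
      proof -
        have "c \<otimes> \<one> \<in> C <#> M" "c \<in> carrier G"
          using that subgroup.one_closed[OF Msub] subgroup.mem_carrier[OF Csub]
          unfolding set_mult_def by blast+
        then show ?thesis
          using prod by simp
      qed
      then show ?thesis
        unfolding C_def by blast
    next
      assume "C <#> M = L"
      then have "x \<in> M"
        using self_in_unit_class_mod[OF M xc] x unfolding C_def by simp
      then show ?thesis
        by (rule unit_class_subset_normal[OF M])
    qed
  qed
  have "h \<otimes> k \<otimes> inv h \<otimes> inv k \<in> M" if h: "h \<in> L" and k: "k \<in> carrier G" for h k
  proof -
    have hc: "h \<in> carrier G"
      using h by (rule subgroup.mem_carrier[OF Lsub])
    \<comment> \<open>The inverse \<open>k h k\<^sup>-\<^sup>1 h\<^sup>-\<^sup>1\<close> of this commutator is \<open>[k\<^sup>-\<^sup>1, h\<^sup>-\<^sup>1]\<close>.\<close>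
    have "inv (inv k) \<otimes> inv (inv h) \<otimes> inv k \<otimes> inv h \<in> unit_class G (inv h)"
      unfolding unit_class_def using k by blast
    then have "k \<otimes> h \<otimes> inv k \<otimes> inv h \<in> M"
      using class_le subgroup.m_inv_closed[OF Lsub h] hc k by auto
    then have "inv (k \<otimes> h \<otimes> inv k \<otimes> inv h) \<in> M"
      by (rule subgroup.m_inv_closed[OF Msub])
    then show ?thesis
      using hc k by (simp add: m_assoc inv_mult_group)
  qed
  then show ?thesis
    unfolding commutator_subgroup_def by (intro generate_subgroup_incl[OF _ Msub]) blast
qed

lemma max_n_imp_maximal_normal_below:
  assumes max: "max_n G" and proper: "L \<noteq> {\<one>}" and L: "L \<lhd> G"
  obtains M where "M \<lhd> G" "M \<subset> L"
    "\<And>K. \<lbrakk>K \<lhd> G; M \<subseteq> K; K \<subseteq> L\<rbrakk> \<Longrightarrow> K = M \<or> K = L"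
proof (rule ccontr)
  assume no: "\<not> thesis"
  have "\<exists>N :: nat \<Rightarrow> 'a set. \<forall>n. (N n \<lhd> G \<and> N n \<subset> L) \<and> N n \<subset> N (Suc n)"
  proof (rule dependent_nat_choice)
    have "\<one> \<in> L"
      using L by (simp add: normal_imp_subgroup subgroup.one_closed)
    then show "\<exists>M. M \<lhd> G \<and> M \<subset> L"
      using one_is_normal proper by blast
  next
    fix M and n :: nat
    assume "M \<lhd> G \<and> M \<subset> L"
    then have "\<exists>K. K \<lhd> G \<and> M \<subseteq> K \<and> K \<subseteq> L \<and> K \<noteq> M \<and> K \<noteq> L"
      using no that[of M] by blast
    then show "\<exists>K. (K \<lhd> G \<and> K \<subset> L) \<and> M \<subset> K"
      by blast
  qed
  then obtain N :: "nat \<Rightarrow> 'a set" where N: "\<And>n. N n \<lhd> G" "\<And>n. N n \<subset> N (Suc n)"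
    by blast
  then obtain m where "\<forall>i\<ge>m. N i = N m"
    using max unfolding max_n_def by (meson psubset_imp_subset)
  then have "N (Suc m) = N m"
    by (meson le_SucI order_refl)
  then show False
    using N(2)[of m] by simp
qed

end


section \<open>Nilpotency\<close>

theorem theorem3:
  fixes G :: "('a, 'b) monoid_scheme" (structure)
  assumes "group G"
    and "min_n G"
    and "max_n G"
    and "\<And>h. h \<in> carrier G \<Longrightarrow> subgroup (unit_class G h) G"
  shows "nilpotent_group G"
proof -
  interpret group G by fact
  have "lower_central G (Suc n) \<subseteq> lower_central G n" for n
    using commutator_subgroup_subset_normal[OF lower_central_normal] by simp
  then obtain m where "\<forall>i\<ge>m. lower_central G i = lower_central G m"
    using assms(2) lower_central_normal unfolding min_n_def by meson
  then have stable: "lower_central G (Suc m) = lower_central G m"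
    by (meson le_SucI order_refl)
  define L where "L = lower_central G m"
  have L: "L \<lhd> G"
    unfolding L_def by (rule lower_central_normal)
  have "L = {\<one>}"
  proof (rule ccontr)
    assume "L \<noteq> {\<one>}"
    then obtain M where M: "M \<lhd> G" "M \<subset> L"
      "\<And>K. \<lbrakk>K \<lhd> G; M \<subseteq> K; K \<subseteq> L\<rbrakk> \<Longrightarrow> K = M \<or> K = L"
      using max_n_imp_maximal_normal_below[OF assms(3) _ L] by blast
    then have "commutator_subgroup G L (carrier G) \<subseteq> M"
      using chief_factor_central[OF L M(1) _ M(3) assms(4)] by blast
    moreover have "commutator_subgroup G L (carrier G) = L"
      using stable by (simp add: L_def)
    ultimately show False
      using M(2) by blast
  qed
  then show ?thesis
    unfolding nilpotent_group_def L_def by blast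
qed

end
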